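(* Let $u$ be a Leray–Hopf solution of the Navier–Stokes equations (unit viscosity, no force) on $\mathbb R^3$, on a time interval containing $(t_0-1,t_0)$; let $0<\sigma<1$, $\Gamma>1$, $r_k=2^{-k}$, $\ell_k=\sigma r_k$. With $\mu_k^{\mathrm{far,ann}}$, $\mathfrak A_{j,k}$, $\mathfrak A_j$, $\mathcal Q_k$ as defined in the context, there is a constant $C_0=C_0(\Gamma,\sigma,\chi,\varphi)$ such that for every $k\ge0$, $$\mu_k^{\mathrm{far,ann}}\le C_0\sum_{j=0}^{k}2^{-(k-j)}\mathfrak A_{j,k}\,\mathcal Q_k\le C_0\sum_{j=0}^{k}2^{-(k-j)}\mathfrak A_j\,\mathcal Q_k .$$ Consequently, for every $N$, $$\sum_{k=0}^{N}\mu_k^{\mathrm{far,ann}}\le C_0\sum_{j=0}^{N}\mathfrak A_j\sum_{m=0}^{N-j}2^{-m}\mathcal Q_{j+m}.$$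
   Context: Fix $(x_0,t_0)$; $I_k=(t_0-r_k^2,t_0)$, $Q_k=B_{r_k}(x_0)\times I_k$. Filter: $\varphi\in C_c^\infty(B_1(0))$, $\varphi\ge0$, $\int\varphi=1$, $\varphi_\ell(x)=\ell^{-3}\varphi(x/\ell)$; $\Omega_k=\operatorname{curl}(\varphi_{\ell_k}*u)$ (convolution in space). Cutoffs $\chi_k(x,t)=\chi((x-x_0)/r_k,(t-t_0)/r_k^2)$ are parabolic rescalings of one fixed smooth profile $0\le\chi\le1$ compactly supported in $B_1(0)\times(-1,0)$. Strain kernel: $K\Omega$ denotes the tensor with entries $K_{ijm}\Omega_m$, $K_{ijm}(z)=\frac{3}{8\pi|z|^5}(z_j\varepsilon_{ikm}z_k+z_i\varepsilon_{jkm}z_k)$ ($\varepsilon$ the Levi-Civita symbol, repeated indices summed). Shells: for $x\in B_{r_k}(x_0)$ and $m\ge0$, $A_{k,m}(x)=\{y:\Gamma2^mr_k<|x-y|\le2\Gamma2^mr_k\}$ and $\mathbb S_{k,m}(x,t)=\int_{A_{k,m}(x)}K(x-y)\Omega_k(y,t)\,dy$. The annular far-field quantity is the contribution of the shells $0\le m\le k$ to the positive far-field stretching: $$\mu_k^{\mathrm{far,ann}}=r_k\iint_{Q_k}\chi_k\Bigl(\sum_{m=0}^{k}\mathbb S_{k,m}\,\Omega_k\cdot\Omega_k\Bigr)_+dx\,dt .$$ Reservoirs: $\widetilde A_j=\{y:(\Gamma-1)r_j<|y-x_0|\le(2\Gamma+1)r_j\}$, $$\mathfrak A_{j,k}=\Bigl(r_j^{-1}\iint_{I_k\times\widetilde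 A_j}|\Omega_k|^2\Bigr)^{1/2}\ (j\le k),\qquad \mathfrak A_j=\sup_{k\ge j}\mathfrak A_{j,k}\in[0,\infty],$$ $$\mathcal Q_k=\Bigl(\int_{I_k}\Bigl(\int_{B_{2r_k}(x_0)}\chi_k|\Omega_k|^2\,dx\Bigr)^2dt\Bigr)^{1/2}.$$ *)

theory Defs
  imports "HOL-Analysis.Analysis"
begin

text \<open>
  Velocity fields are written \<open>u t x\<close> (time first), so that \<open>u t\<close> is a function on
  \<open>\<real>\<^sup>3\<close>; points of space-time are pairs \<open>(x, t)\<close>.
  All integrals are with respect to Lebesgue measure. Integrals of nonnegative functions are
  taken in \<open>[0, \<infinity>]\<close> (type \<^typ>\<open>ennreal\<close>, where \<open>0 * \<infinity> = 0\<close>).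
\<close>

section \<open>Smooth functions and test functions\<close>

text \<open>Continuous differentiability of order n on the whole space, through partial derivatives.\<close>

primrec C_n :: "nat \<Rightarrow> ('a::euclidean_space \<Rightarrow> 'b::real_normed_vector) \<Rightarrow> bool" where
  "C_n 0 f \<longleftrightarrow> continuous_on UNIV f"
| "C_n (Suc n) f \<longleftrightarrow> (\<forall>x. f differentiable (at x)) \<and>
     (\<forall>e\<in>Basis. C_n n (\<lambda>x. frechet_derivative f (at x) e))"

definition test_function ::
    "'a::euclidean_space set \<Rightarrow> ('a \<Rightarrow> 'b::real_normed_vector) \<Rightarrow> bool" where
  "test_function U \<psi> \<longleftrightarrow> (\<forall>n. C_n n \<psi>) \<and>
     compact (closure {x. \<psi> x \<noteq> 0}) \<and> closure {x. \<psi> x \<noteq> 0} \<subseteq> U"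

section \<open>Vector calculus\<close>

definition levi_civita :: "3 \<Rightarrow> 3 \<Rightarrow> 3 \<Rightarrow> real" where
  "levi_civita i j k =
     (if (i, j, k) \<in> {(1, 2, 3), (2, 3, 1), (3, 1, 2)} then 1
      else if (i, j, k) \<in> {(3, 2, 1), (2, 1, 3), (1, 3, 2)} then - 1
      else 0)"

text \<open>The entry \<open>(i, j)\<close> of \<^const>\<open>jacobian\<close> is the j-th partial derivative of the i-th component.\<close>

definition curl :: "(real^3 \<Rightarrow> real^3) \<Rightarrow> real^3 \<Rightarrow> real^3" where
  "curl v x = (\<chi> i. \<Sum>j\<in>UNIV. \<Sum>k\<in>UNIV. levi_civita i j k * jacobian v (at x) $ k $ j)"

definition divergence :: "(real^3 \<Rightarrow> real^3) \<Rightarrow> real^3 \<Rightarrow> real" where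
  "divergence v x = trace (jacobian v (at x))"

definition partial :: "3 \<Rightarrow> (real^3 \<Rightarrow> real) \<Rightarrow> real^3 \<Rightarrow> real" where
  "partial j f x = frechet_derivative f (at x) (axis j 1)"

section \<open>Leray--Hopf solutions\<close>

definition square_integrable :: "('a::euclidean_space \<Rightarrow> 'b::euclidean_space) \<Rightarrow> bool" where
  "square_integrable v \<longleftrightarrow> v \<in> borel_measurable lebesgue \<and>
     (\<integral>\<^sup>+x. ennreal ((norm (v x))\<^sup>2) \<partial>lebesgue) < \<infinity>"

definition weakly_div_free :: "(real^3 \<Rightarrow> real^3) \<Rightarrow> bool" where
  "weakly_div_free v \<longleftrightarrow> (\<forall>\<theta>. test_function UNIV \<theta> \<longrightarrow>
     (LINT x|lebesgue. (\<Sum>j\<in>UNIV. v x $ j * partial j \<theta> x)) = 0)"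

definition weak_gradient :: "(real^3 \<Rightarrow> real^3) \<Rightarrow> (real^3 \<Rightarrow> real^3^3) \<Rightarrow> bool" where
  "weak_gradient v G \<longleftrightarrow> (\<forall>\<theta> i j. test_function UNIV \<theta> \<longrightarrow>
     (LINT x|lebesgue. v x $ i * partial j \<theta> x) = - (LINT x|lebesgue. G x $ i $ j * \<theta> x))"

text \<open>
  Leray--Hopf solution of the unforced Navier--Stokes equations with unit viscosity on
  \<open>\<real>\<^sup>3\<close> and the time interval \<open>[a, b)\<close>, with initial datum \<open>u a\<close>. As usual, \<open>u\<close> is the weakly
  continuous representative; \<open>G\<close> is its weak spatial gradient. The weak formulation is tested
  with divergence-free fields, so that no pressure occurs, and in it
  \<open>(u \<cdot> \<nabla>)\<psi>\<close> is the Jacobian of \<open>\<psi>\<close> applied to \<open>u\<close>.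
\<close>

definition leray_hopf :: "real \<Rightarrow> real \<Rightarrow> (real \<Rightarrow> real^3 \<Rightarrow> real^3) \<Rightarrow> bool" where
  "leray_hopf a b u \<longleftrightarrow> a < b \<and>
     (\<lambda>(x, t). u t x) \<in> borel_measurable (lebesgue_on (UNIV \<times> {a..<b})) \<and>
     (\<forall>t\<in>{a..<b}. square_integrable (u t) \<and> weakly_div_free (u t)) \<and>
     (\<exists>M. \<forall>t\<in>{a..<b}. (\<integral>\<^sup>+x. ennreal ((norm (u t x))\<^sup>2) \<partial>lebesgue) \<le> ennreal M) \<and>
     (\<forall>w. square_integrable w \<longrightarrow> continuous_on {a..<b} (\<lambda>t. LINT x|lebesgue. u t x \<bullet> w x)) \<and>
     (\<exists>G :: real \<Rightarrow> real^3 \<Rightarrow> real^3^3.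
        (\<lambda>(x, t). G t x) \<in> borel_measurable (lebesgue_on (UNIV \<times> {a..<b})) \<and>
        (\<integral>\<^sup>+(x, t)\<in>UNIV \<times> {a..<b}. ennreal ((norm (G t x))\<^sup>2) \<partial>lebesgue) < \<infinity> \<and>
        (AE t in lebesgue. t \<in> {a..<b} \<longrightarrow> weak_gradient (u t) (G t)) \<and>
        (\<forall>\<psi> :: (real^3) \<times> real \<Rightarrow> real^3.
           test_function (UNIV \<times> {a<..<b}) \<psi> \<and> (\<forall>x t. divergence (\<lambda>y. \<psi> (y, t)) x = 0) \<longrightarrow>
           (LINT (x, t):UNIV \<times> {a<..<b}|lebesgue.
              u t x \<bullet> frechet_derivative \<psi> (at (x, t)) (0, 1)
              + u t x \<bullet> (jacobian (\<lambda>y. \<psi> (y, t)) (at x) *v u t x)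
              - G t x \<bullet> jacobian (\<lambda>y. \<psi> (y, t)) (at x)) = 0) \<and>
        (\<forall>t\<in>{a..<b}.
           (\<integral>\<^sup>+x. ennreal ((norm (u t x))\<^sup>2) \<partial>lebesgue)
           + 2 * (\<integral>\<^sup>+(x, s)\<in>UNIV \<times> {a<..<t}. ennreal ((norm (G s x))\<^sup>2) \<partial>lebesgue)
           \<le> (\<integral>\<^sup>+x. ennreal ((norm (u a x))\<^sup>2) \<partial>lebesgue)))"

section \<open>Scales, filter and cutoffs\<close>

definition rad :: "nat \<Rightarrow> real" where
  "rad k = (1 / 2) ^ k"

definition time_int :: "real \<Rightarrow> nat \<Rightarrow> real set" where
  "time_int t0 k = {t0 - (rad k)\<^sup>2<..<t0}"

definition cyl :: "real^3 \<Rightarrow> real \<Rightarrow> nat \<Rightarrow> ((real^3) \<times> real) set" where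
  "cyl x0 t0 k = ball x0 (rad k) \<times> time_int t0 k"

definition filter_profile :: "(real^3 \<Rightarrow> real) \<Rightarrow> bool" where
  "filter_profile \<phi> \<longleftrightarrow> test_function (ball 0 1) \<phi> \<and> (\<forall>x. 0 \<le> \<phi> x) \<and> (LINT x|lebesgue. \<phi> x) = 1"

definition mollify :: "(real^3 \<Rightarrow> real) \<Rightarrow> real \<Rightarrow> (real^3 \<Rightarrow> real^3) \<Rightarrow> real^3 \<Rightarrow> real^3" where
  "mollify \<phi> l v x = (LINT y|lebesgue. (\<phi> ((x - y) /\<^sub>R l) / l ^ 3) *\<^sub>R v y)"

definition filtered_vorticity ::
    "(real^3 \<Rightarrow> real) \<Rightarrow> real \<Rightarrow> (real \<Rightarrow> real^3 \<Rightarrow> real^3) \<Rightarrow> nat \<Rightarrow> real \<Rightarrow> real^3 \<Rightarrow> real^3" where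
  "filtered_vorticity \<phi> \<sigma> u k t = curl (mollify \<phi> (\<sigma> * rad k) (u t))"

definition cutoff_profile :: "((real^3) \<times> real \<Rightarrow> real) \<Rightarrow> bool" where
  "cutoff_profile \<eta> \<longleftrightarrow> test_function (ball 0 1 \<times> {-1<..<0}) \<eta> \<and> (\<forall>z. 0 \<le> \<eta> z \<and> \<eta> z \<le> 1)"

definition cutoff ::
    "((real^3) \<times> real \<Rightarrow> real) \<Rightarrow> real^3 \<Rightarrow> real \<Rightarrow> nat \<Rightarrow> real^3 \<Rightarrow> real \<Rightarrow> real" where
  "cutoff \<eta> x0 t0 k x t = \<eta> ((x - x0) /\<^sub>R rad k, (t - t0) / (rad k)\<^sup>2)"

section \<open>Annular far-field stretching\<close>

definition strain_kernel :: "3 \<Rightarrow> 3 \<Rightarrow> 3 \<Rightarrow> real^3 \<Rightarrow> real" where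
  "strain_kernel i j m z = 3 / (8 * pi * norm z ^ 5) *
     (\<Sum>k\<in>UNIV. z $ j * levi_civita i k m * z $ k + z $ i * levi_civita j k m * z $ k)"

definition strain_tensor :: "real^3 \<Rightarrow> real^3 \<Rightarrow> real^3^3" where
  "strain_tensor z \<omega> = (\<chi> i j. \<Sum>m\<in>UNIV. strain_kernel i j m z * \<omega> $ m)"

definition shell :: "real \<Rightarrow> nat \<Rightarrow> nat \<Rightarrow> real^3 \<Rightarrow> (real^3) set" where
  "shell \<Gamma> k m x = {y. \<Gamma> * 2 ^ m * rad k < norm (x - y) \<and> norm (x - y) \<le> 2 * \<Gamma> * 2 ^ m * rad k}"

definition shell_strain ::
    "real \<Rightarrow> (real^3 \<Rightarrow> real) \<Rightarrow> real \<Rightarrow> (real \<Rightarrow> real^3 \<Rightarrow> real^3) \<Rightarrow> nat \<Rightarrow> nat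
      \<Rightarrow> real \<Rightarrow> real^3 \<Rightarrow> real^3^3" where
  "shell_strain \<Gamma> \<phi> \<sigma> u k m t x =
     (LINT y:shell \<Gamma> k m x|lebesgue. strain_tensor (x - y) (filtered_vorticity \<phi> \<sigma> u k t y))"

definition mu_far_ann ::
    "real \<Rightarrow> ((real^3) \<times> real \<Rightarrow> real) \<Rightarrow> (real^3 \<Rightarrow> real) \<Rightarrow> real \<Rightarrow> real^3 \<Rightarrow> real
      \<Rightarrow> (real \<Rightarrow> real^3 \<Rightarrow> real^3) \<Rightarrow> nat \<Rightarrow> ennreal" where
  "mu_far_ann \<Gamma> \<eta> \<phi> \<sigma> x0 t0 u k = ennreal (rad k) *
     (\<integral>\<^sup>+(x, t)\<in>cyl x0 t0 k.
        (let \<omega> = filtered_vorticity \<phi> \<sigma> u k t x in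
         ennreal (cutoff \<eta> x0 t0 k x t *
           max 0 (((\<Sum>m=0..k. shell_strain \<Gamma> \<phi> \<sigma> u k m t x) *v \<omega>) \<bullet> \<omega>))) \<partial>lebesgue)"

section \<open>Reservoirs\<close>

definition ennreal_sqrt :: "ennreal \<Rightarrow> ennreal" where
  "ennreal_sqrt a = (if a = \<infinity> then \<infinity> else ennreal (sqrt (enn2real a)))"

definition reservoir_annulus :: "real \<Rightarrow> real^3 \<Rightarrow> nat \<Rightarrow> (real^3) set" where
  "reservoir_annulus \<Gamma> x0 j =
     {y. (\<Gamma> - 1) * rad j < norm (y - x0) \<and> norm (y - x0) \<le> (2 * \<Gamma> + 1) * rad j}"

definition reservoir_at ::
    "real \<Rightarrow> (real^3 \<Rightarrow> real) \<Rightarrow> real \<Rightarrow> real^3 \<Rightarrow> real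
      \<Rightarrow> (real \<Rightarrow> real^3 \<Rightarrow> real^3) \<Rightarrow> nat \<Rightarrow> nat \<Rightarrow> ennreal" where
  "reservoir_at \<Gamma> \<phi> \<sigma> x0 t0 u j k = ennreal_sqrt (ennreal (1 / rad j) *
     (\<integral>\<^sup>+(x, t)\<in>reservoir_annulus \<Gamma> x0 j \<times> time_int t0 k.
        ennreal ((norm (filtered_vorticity \<phi> \<sigma> u k t x))\<^sup>2) \<partial>lebesgue))"

definition reservoir ::
    "real \<Rightarrow> (real^3 \<Rightarrow> real) \<Rightarrow> real \<Rightarrow> real^3 \<Rightarrow> real
      \<Rightarrow> (real \<Rightarrow> real^3 \<Rightarrow> real^3) \<Rightarrow> nat \<Rightarrow> ennreal" where
  "reservoir \<Gamma> \<phi> \<sigma> x0 t0 u j = (SUP k\<in>{j..}. reservoir_at \<Gamma> \<phi> \<sigma> x0 t0 u j k)"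

definition local_quartic ::
    "((real^3) \<times> real \<Rightarrow> real) \<Rightarrow> (real^3 \<Rightarrow> real) \<Rightarrow> real \<Rightarrow> real^3 \<Rightarrow> real
      \<Rightarrow> (real \<Rightarrow> real^3 \<Rightarrow> real^3) \<Rightarrow> nat \<Rightarrow> ennreal" where
  "local_quartic \<eta> \<phi> \<sigma> x0 t0 u k = ennreal_sqrt
     (\<integral>\<^sup>+t\<in>time_int t0 k.
        (\<integral>\<^sup>+x\<in>ball x0 (2 * rad k).
           ennreal (cutoff \<eta> x0 t0 k x t * (norm (filtered_vorticity \<phi> \<sigma> u k t x))\<^sup>2) \<partial>lebesgue)\<^sup>2
        \<partial>lebesgue)"

end

theory Submission
  imports Defs
begin

text \<open>
  For \<open>x\<close> in the ball of radius \<open>r\<^sub>k\<close> about \<open>x\<^sub>0\<close>, the \<open>m\<close>-th shell about \<open>x\<close> lies in the reservoir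
  annulus of index \<open>j = k - m\<close>, and the strain kernel there is \<open>O(r\<^sub>j\<^sup>-\<^sup>3)\<close>. Cauchy--Schwarz on the
  annulus, whose volume is \<open>O(r\<^sub>j\<^sup>3)\<close>, bounds the shell strain by \<open>r\<^sub>j\<close> to the power \<open>-3/2\<close> times the
  spatial \<open>L\<^sup>2\<close> norm of the filtered vorticity on the annulus; Cauchy--Schwarz in time then produces
  the reservoir and the local quartic quantity with the factor \<open>r\<^sub>k / r\<^sub>j\<close>. Tonelli needs the
  filtered vorticity to be jointly measurable. It is even jointly continuous: a derivative of the
  filter is a continuous compactly supported kernel, so the convolution is continuous in time by
  weak continuity of \<open>u\<close>, and continuous in space uniformly in time by the energy bound.
\<close>

section \<open>Convolution with compactly supported kernels\<close>

text \<open>This is a real-valued Bochner integral, which defaults to 0 when the integrand is not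
  integrable; it is the squared L2 norm only for square integrable \<open>v\<close>.\<close>

definition energy :: "('a::euclidean_space \<Rightarrow> 'b::euclidean_space) \<Rightarrow> real" where
  "energy v = (LINT y|lebesgue. (norm (v y))\<^sup>2)"

definition conv ::
    "('a::euclidean_space \<Rightarrow> real) \<Rightarrow> ('a \<Rightarrow> 'b::euclidean_space) \<Rightarrow> 'a \<Rightarrow> 'b" where
  "conv p v x = (LINT y|lebesgue. p (x - y) *\<^sub>R v y)"

lemma square_integrable_integrable:
  assumes "square_integrable v"
  shows "integrable lebesgue (\<lambda>y. (norm (v y))\<^sup>2)"
  using assms unfolding square_integrable_def
  by (intro integrableI_nonneg) auto

text \<open>The pointwise bound |v| at most 1 + |v|^2 replaces Cauchy-Schwarz. The estimate is
  linear in \<open>e\<close> and sees \<open>v\<close> only through its energy, so a uniformly small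
  kernel of bounded support gives an integral small uniformly over fields of bounded energy.\<close>

lemma weighted_square_integrable:
  fixes v :: "'a::euclidean_space \<Rightarrow> 'b::euclidean_space"
  assumes v: "square_integrable v" and q: "q \<in> borel_measurable borel" and e: "0 \<le> e"
    and le: "\<And>y. \<bar>q y\<bar> \<le> e * indicator (cball c R) y"
  shows "integrable lebesgue (\<lambda>y. q y *\<^sub>R v y)"
    and "norm (LINT y|lebesgue. q y *\<^sub>R v y) \<le> e * (measure lebesgue (cball c R) + energy v)"
proof -
  have vm: "v \<in> borel_measurable lebesgue"
    using v by (simp add: square_integrable_def)
  have ind: "integrable lebesgue (indicator (cball c R) :: 'a \<Rightarrow> real)"
    by (rule integrable_real_indicator)
       (use emeasure_bounded_finite[OF bounded_cball, of c R] in auto)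
  have dom: "integrable lebesgue (\<lambda>y. e * (indicator (cball c R) y + (norm (v y))\<^sup>2))"
    by (intro integrable_mult_right Bochner_Integration.integrable_add
          square_integrable_integrable[OF v] ind)
  have bd: "norm (q y *\<^sub>R v y) \<le> e * (indicator (cball c R) y + (norm (v y))\<^sup>2)" for y
  proof (cases "y \<in> cball c R")
    case True
    have "0 \<le> (norm (v y) - 1)\<^sup>2" "0 \<le> norm (v y)" by auto
    then have "norm (v y) \<le> 1 + (norm (v y))\<^sup>2"
      unfolding power2_diff one_power2 mult_1_right by linarith
    with le[of y] True e have "\<bar>q y\<bar> * norm (v y) \<le> e * (1 + (norm (v y))\<^sup>2)"
      by (intro mult_mono) auto
    with True show ?thesis by simp
  next
    case False
    with le[of y] e show ?thesis by simp
  qed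
  have "q \<in> borel_measurable lebesgue"
    using q by (simp add: measurable_completion)
  then have meas: "(\<lambda>y. q y *\<^sub>R v y) \<in> borel_measurable lebesgue"
    using vm by (rule borel_measurable_scaleR)
  show int: "integrable lebesgue (\<lambda>y. q y *\<^sub>R v y)"
    by (rule Bochner_Integration.integrable_bound[OF dom meas])
       (use order_trans[OF bd abs_ge_self] in \<open>auto\<close>)
  have "norm (LINT y|lebesgue. q y *\<^sub>R v y) \<le>
      (LINT y|lebesgue. e * (indicator (cball c R) y + (norm (v y))\<^sup>2))"
    by (rule order_trans[OF integral_norm_bound integral_mono[OF integrable_norm[OF int] dom bd]])
  also have "\<dots> = e * (measure lebesgue (cball c R) + energy v)"
    using ind square_integrable_integrable[OF v] by (simp add: energy_def)
  finally show "norm (LINT y|lebesgue. q y *\<^sub>R v y) \<le> e * (measure lebesgue (cball c R) + energy v)" .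
qed

text \<open>Heine-Cantor applies on the ball of radius \<open>R + 1\<close>; if two points at
  distance less than 1 are not both in it, then both lie beyond \<open>R\<close>, where
  \<open>p\<close> vanishes.\<close>

lemma uniformly_continuous_compact_support:
  fixes p :: "'a::euclidean_space \<Rightarrow> 'b::real_normed_vector"
  assumes cont: "continuous_on UNIV p" and supp: "\<And>z. R < norm z \<Longrightarrow> p z = 0"
  shows "uniformly_continuous_on UNIV p"
proof -
  have uc: "uniformly_continuous_on (cball 0 (R + 1)) p"
    using cont by (intro compact_uniformly_continuous) (auto intro: continuous_on_subset)
  show ?thesis
    unfolding uniformly_continuous_on_def
  proof (intro allI impI)
    fix e :: real assume "0 < e"
    then obtain d where d: "0 < d"
      "\<And>z z'. z \<in> cball 0 (R + 1) \<Longrightarrow> z' \<in> cball 0 (R + 1) \<Longrightarrow> dist z' z < d \<Longrightarrow> dist (p z') (p z) < e"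
      using uc unfolding uniformly_continuous_on_def by meson
    have "dist (p z') (p z) < e" if "dist z' z < min d 1" for z z'
    proof (cases "z \<in> cball 0 (R + 1) \<and> z' \<in> cball 0 (R + 1)")
      case True with d that show ?thesis by auto
    next
      case False
      have "norm z \<le> norm z' + dist z' z" "norm z' \<le> norm z + dist z' z"
        by norm+
      with False that have "R < norm z" "R < norm z'" by auto
      with supp \<open>0 < e\<close> show ?thesis by simp
    qed
    with d show "\<exists>d>0. \<forall>x\<in>UNIV. \<forall>x'\<in>UNIV. dist x' x < d \<longrightarrow> dist (p x') (p x) < e"
      by (intro exI[of _ "min d 1"]) auto
  qed
qed

lemma bounded_compact_support:
  fixes p :: "'a::euclidean_space \<Rightarrow> real"
  assumes cont: "continuous_on UNIV p" and supp: "\<And>z. R < norm z \<Longrightarrow> p z = 0"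
  obtains B where "0 \<le> B" "\<And>z. \<bar>p z\<bar> \<le> B * indicator (cball 0 R) z"
proof -
  have "bounded (p ` cball 0 R)"
    using cont by (intro compact_imp_bounded compact_continuous_image) (auto intro: continuous_on_subset)
  then obtain B where B: "0 < B" "\<And>z. z \<in> cball 0 R \<Longrightarrow> \<bar>p z\<bar> \<le> B"
    unfolding bounded_pos by auto
  show thesis
    by (rule that[of B]) (use B supp in \<open>auto simp: indicator_def not_le\<close>)
qed

section \<open>Integrability and differentiation of convolutions\<close>

lemma conv_integrable:
  fixes p :: "'a::euclidean_space \<Rightarrow> real"
  assumes v: "square_integrable v"
    and cont: "continuous_on UNIV p" and supp: "\<And>z. R < norm z \<Longrightarrow> p z = 0"
  shows "integrable lebesgue (\<lambda>y. p (x - y) *\<^sub>R v y)"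
proof -
  obtain B where B: "0 \<le> B" "\<And>z. \<bar>p z\<bar> \<le> B * indicator (cball 0 R) z"
    using bounded_compact_support[OF cont supp] by blast
  have "\<bar>p (x - y)\<bar> \<le> B * indicator (cball x R) y" for y
    using B(2)[of "x - y"] by (simp add: indicator_def dist_norm norm_minus_commute)
  moreover have "(\<lambda>y. p (x - y)) \<in> borel_measurable borel"
    by (intro borel_measurable_continuous_onI continuous_on_compose2[OF cont] continuous_intros) auto
  ultimately show ?thesis
    using v B(1) by (intro weighted_square_integrable(1))
qed

text \<open>The partial derivatives are uniformly continuous, so \<open>D\<close> varies little in
  operator norm over short distances, and the mean value inequality bounds the remainder. Uniformity
  in \<open>z\<close> is what later allows differentiation under the integral.\<close>

lemma uniform_linearization:
  fixes \<psi> :: "'a::euclidean_space \<Rightarrow> real"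
  assumes der: "\<And>z. (\<psi> has_derivative D z) (at z)"
    and cont: "\<And>h. continuous_on UNIV (\<lambda>z. D z h)"
    and supp: "\<And>z h. R < norm z \<Longrightarrow> D z h = 0"
    and e: "0 < e"
  shows "\<exists>d>0. \<forall>z h. norm h < d \<longrightarrow> \<bar>\<psi> (z + h) - \<psi> z - D z h\<bar> \<le> e * norm h"
proof -
  \<comment> \<open>The operator norm is estimated by a sum of \<open>DIM('a)\<close> terms, one per
    basis direction, each at most \<open>e'\<close> times the norm of \<open>h\<close>.\<close>
  define e' where "e' = e / DIM('a)"
  have e': "0 < e'" using e by (simp add: e'_def)
  have "\<forall>i\<in>Basis. \<exists>d>0. \<forall>z z'. dist z' z < d \<longrightarrow> \<bar>D z' i - D z i\<bar> < e'"
  proof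
    fix i :: 'a
    have "uniformly_continuous_on UNIV (\<lambda>z. D z i)"
      by (rule uniformly_continuous_compact_support[OF cont supp])
    with e' show "\<exists>d>0. \<forall>z z'. dist z' z < d \<longrightarrow> \<bar>D z' i - D z i\<bar> < e'"
      unfolding uniformly_continuous_on_def by (auto simp: dist_real_def)
  qed
  then obtain d where d: "\<And>i. i \<in> Basis \<Longrightarrow> 0 < d i"
      "\<And>i z z'. i \<in> Basis \<Longrightarrow> dist z' z < d i \<Longrightarrow> \<bar>D z' i - D z i\<bar> < e'"
    by metis
  define \<delta> where "\<delta> = Min (d ` Basis)"
  have \<delta>: "0 < \<delta>" "\<And>i. i \<in> Basis \<Longrightarrow> \<delta> \<le> d i"
    using d(1) by (auto simp: \<delta>_def)
  have lin: "bounded_linear (D z)" for z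
    using der has_derivative_bounded_linear by blast
  have on: "onorm (D z' - D z) \<le> e" if "dist z' z < \<delta>" for z z'
  proof (rule onorm_bound)
    fix h :: 'a
    have bl: "bounded_linear (\<lambda>h. D z' h - D z h)"
      by (intro bounded_linear_sub lin)
    have "norm ((D z' - D z) h) = norm (\<Sum>i\<in>Basis. (h \<bullet> i) *\<^sub>R (D z' i - D z i))"
      by (subst euclidean_representation[of h, symmetric])
         (simp only: fun_diff_def linear_sum[OF bounded_linear.linear[OF bl]]
            linear_scale[OF bounded_linear.linear[OF bl]])
    also have "\<dots> \<le> (\<Sum>i\<in>(Basis::'a set). norm h * e')"
    proof (rule sum_norm_le)
      fix i :: 'a assume i: "i \<in> Basis"
      then have "\<bar>D z' i - D z i\<bar> \<le> e'"
        using d(2)[OF i, of z' z] \<delta>(2)[OF i] that by simp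
      then show "norm ((h \<bullet> i) *\<^sub>R (D z' i - D z i)) \<le> norm h * e'"
        using Basis_le_norm[OF i, of h] by (auto simp: abs_mult intro!: mult_mono)
    qed
    also have "\<dots> = e * norm h" by (simp add: e'_def)
    finally show "norm ((D z' - D z) h) \<le> e * norm h" .
  qed (use e in simp)
  have "\<bar>\<psi> (z + h) - \<psi> z - D z h\<bar> \<le> e * norm h" if "norm h < \<delta>" for z h
  proof -
    have "norm (\<psi> (z + h) - \<psi> z - D z (z + h - z)) \<le> norm (z + h - z) * e"
    proof (rule differentiable_bound_linearization[where S = "ball z \<delta>"])
      show "z + t *\<^sub>R (z + h - z) \<in> ball z \<delta>" if "t \<in> {0..1}" for t
      proof -
        have "\<bar>t\<bar> * norm h \<le> 1 * norm h" using that by (intro mult_right_mono) auto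
        with \<open>norm h < \<delta>\<close> show ?thesis by (simp add: dist_norm)
      qed
      show "(\<psi> has_derivative D y) (at y within ball z \<delta>)" for y
        using der has_derivative_at_withinI by blast
      show "onorm (D y - D z) \<le> e" if "y \<in> ball z \<delta>" for y
        using that by (intro on) (simp add: dist_commute)
    qed (use \<delta>(1) in simp)
    then show ?thesis by (simp add: mult.commute)
  qed
  with \<delta>(1) show ?thesis by blast
qed

text \<open>The linearization error of the convolution is the integral of \<open>v\<close> against
  the linearization error \<open>q\<close> of the kernel. That error is uniformly small and
  supported in a fixed ball, so the weighted estimate applies and no dominated convergence argument
  is made.\<close>

lemma conv_has_derivative:
  fixes \<psi> :: "'a::euclidean_space \<Rightarrow> real"
  assumes v: "square_integrable v"
    and der: "\<And>z. (\<psi> has_derivative D z) (at z)"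
    and cont: "\<And>h. continuous_on UNIV (\<lambda>z. D z h)"
    and supp: "\<And>z. R < norm z \<Longrightarrow> \<psi> z = 0" and supp': "\<And>z h. R < norm z \<Longrightarrow> D z h = 0"
  shows "(conv \<psi> v has_derivative (\<lambda>h. conv (\<lambda>z. D z h) v x)) (at x)"
proof -
  have cont\<psi>: "continuous_on UNIV \<psi>"
    by (intro continuous_at_imp_continuous_on ballI has_derivative_continuous[OF der])
  have lin: "linear (D z)" for z
    using der has_derivative_linear by blast
  note intD = conv_integrable[OF v cont supp', of R]
  note int\<psi> = conv_integrable[OF v cont\<psi> supp, of R]
  have "linear (\<lambda>h. conv (\<lambda>z. D z h) v x)"
    by (rule linearI)
       (simp_all add: conv_def linear_add[OF lin] linear_scale[OF lin] scaleR_add_left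
          Bochner_Integration.integral_add[OF intD intD] flip: scaleR_scaleR)
  then have bl: "bounded_linear (\<lambda>h. conv (\<lambda>z. D z h) v x)"
    by (simp add: linear_conv_bounded_linear)
  define M where "M = measure lebesgue (cball x (R + 1)) + energy v"
  have M: "0 \<le> M" by (simp add: M_def energy_def)
  have "\<exists>d>0. \<forall>y. norm (y - x) < d \<longrightarrow>
      norm (conv \<psi> v y - conv \<psi> v x - conv (\<lambda>z. D z (y - x)) v x) \<le> e * norm (y - x)"
    if e: "0 < e" for e
  proof -
    \<comment> \<open>\<open>M\<close> may be 0, so the division is by \<open>M + 1\<close>; the
      surplus factor \<open>M / (M + 1)\<close> is at most 1 at the end.\<close>
    from e M have "0 < e / (M + 1)" by simp
    from uniform_linearization[OF der cont supp' this]
    obtain d where d: "0 < d"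
      "\<And>z h. norm h < d \<Longrightarrow> \<bar>\<psi> (z + h) - \<psi> z - D z h\<bar> \<le> e / (M + 1) * norm h"
      by blast
    have "norm (conv \<psi> v (x + h) - conv \<psi> v x - conv (\<lambda>z. D z h) v x) \<le> e * norm h"
      \<comment> \<open>The bound 1 on the increment keeps the support of \<open>q\<close> in the
        ball of radius \<open>R + 1\<close> about \<open>x\<close>, whatever \<open>h\<close>
        is.\<close>
      if h: "norm h < min d 1" for h
    proof -
      define q where "q y = \<psi> (x + h - y) - \<psi> (x - y) - D (x - y) h" for y
      have "conv \<psi> v (x + h) - conv \<psi> v x - conv (\<lambda>z. D z h) v x = (LINT y|lebesgue. q y *\<^sub>R v y)"
        using intD int\<psi> by (simp add: conv_def q_def scaleR_diff_left)
      also have "norm \<dots> \<le> e / (M + 1) * norm h * M"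
        unfolding M_def
      proof (rule weighted_square_integrable(2)[OF v])
        show "q \<in> borel_measurable borel"
          unfolding q_def
          by (intro borel_measurable_continuous_onI continuous_intros
              continuous_on_compose2[OF cont\<psi>] continuous_on_compose2[OF cont]) auto
        show "\<bar>q y\<bar> \<le> e / (measure lebesgue (cball x (R + 1)) + energy v + 1) * norm h *
            indicator (cball x (R + 1)) y" for y
        proof (cases "y \<in> cball x (R + 1)")
          case True
          then show ?thesis
            using d(2)[of h "x - y"] h by (simp add: q_def M_def algebra_simps)
        next
          case False
          then have "R + 1 < norm (x - y)" by (simp add: dist_norm)
          moreover have "norm (x - y) \<le> norm (x + h - y) + norm h" by norm
          ultimately have "R < norm (x - y)" "R < norm (x + h - y)"
            using h by auto
          then show ?thesis
            using False supp supp' by (simp add: q_def)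
        qed
      qed (use e M in \<open>simp add: M_def\<close>)
      also have "\<dots> = e * norm h * (M / (M + 1))" by simp
      also have "\<dots> \<le> e * norm h * 1"
        using e M by (intro mult_left_mono) auto
      finally show ?thesis by simp
    qed
    from this[of "y - x" for y] d(1) show ?thesis
      by (intro exI[of _ "min d 1"]) auto
  qed
  with bl show ?thesis
    unfolding has_derivative_at_alt by blast
qed

section \<open>Joint continuity in space and time\<close>

text \<open>Separate continuity would not suffice: the spatial modulus of continuity is uniform in
  \<open>t\<close> by the energy bound, and this combines with continuity in time at one fixed
  \<open>x\<close>.\<close>

lemma conv_jointly_continuous:
  fixes p :: "'a::euclidean_space \<Rightarrow> real" and u :: "'t::metric_space \<Rightarrow> 'a \<Rightarrow> 'b::euclidean_space"
  assumes u: "\<And>t. t \<in> T \<Longrightarrow> square_integrable (u t)"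
    and M: "\<And>t. t \<in> T \<Longrightarrow> energy (u t) \<le> M"
    and weak: "\<And>w. square_integrable w \<Longrightarrow> continuous_on T (\<lambda>t. LINT y|lebesgue. u t y \<bullet> w y)"
    and cont: "continuous_on UNIV p" and supp: "\<And>z. R < norm z \<Longrightarrow> p z = 0"
  shows "continuous_on (UNIV \<times> T) (\<lambda>(x, t). conv p (u t) x)"
proof -
  have in_time: "continuous_on T (\<lambda>t. conv p (u t) x)" for x
  proof (subst continuous_on_componentwise, intro ballI)
    fix i :: 'b assume "i \<in> Basis"
    obtain B where B: "0 \<le> B" "\<And>z. \<bar>p z\<bar> \<le> B * indicator (cball 0 R) z"
      using bounded_compact_support[OF cont supp] by blast
    have bd: "\<bar>p (x - y)\<bar> \<le> B * indicator (cball x R) y" for y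
      using B(2)[of "x - y"] by (simp add: indicator_def dist_norm norm_minus_commute)
    have p_meas: "(\<lambda>y. p (x - y)) \<in> borel_measurable borel"
      by (intro borel_measurable_continuous_onI continuous_on_compose2[OF cont] continuous_intros) auto
    \<comment> \<open>A component of the convolution at fixed \<open>x\<close> is the pairing of
      \<open>u t\<close> with this field, which makes it an admissible test field for weak
      continuity.\<close>
    have "square_integrable (\<lambda>y. p (x - y) *\<^sub>R i)"
      unfolding square_integrable_def
    proof
      show "(\<lambda>y. p (x - y) *\<^sub>R i) \<in> borel_measurable lebesgue"
        using p_meas by (intro borel_measurable_scaleR) (auto intro: measurable_completion)
      have "(\<integral>\<^sup>+y. ennreal ((norm (p (x - y) *\<^sub>R i))\<^sup>2) \<partial>lebesgue)
          \<le> (\<integral>\<^sup>+y. ennreal (B\<^sup>2) * indicator (cball x R) y \<partial>lebesgue)"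
      proof (intro nn_integral_mono)
        fix y
        show "ennreal ((norm (p (x - y) *\<^sub>R i))\<^sup>2) \<le> ennreal (B\<^sup>2) * indicator (cball x R) y"
          using power_mono[OF bd[of y] abs_ge_zero, of 2] \<open>i \<in> Basis\<close>
          by (cases "y \<in> cball x R") auto
      qed
      also have "\<dots> = ennreal (B\<^sup>2) * emeasure lborel (cball x R)"
        by (simp add: nn_integral_cmult_indicator)
      also have "\<dots> < \<infinity>"
        using emeasure_bounded_finite[OF bounded_cball, of x R] by (simp add: ennreal_mult_less_top)
      finally show "(\<integral>\<^sup>+y. ennreal ((norm (p (x - y) *\<^sub>R i))\<^sup>2) \<partial>lebesgue) < \<infinity>" .
    qed
    then have "continuous_on T (\<lambda>t. LINT y|lebesgue. u t y \<bullet> (p (x - y) *\<^sub>R i))"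
      by (rule weak)
    moreover have "conv p (u t) x \<bullet> i = (LINT y|lebesgue. u t y \<bullet> (p (x - y) *\<^sub>R i))" if "t \<in> T" for t
      unfolding conv_def
      using integral_inner_left[OF conv_integrable[OF u[OF that] cont supp, of R], of i x] by simp
    ultimately show "continuous_on T (\<lambda>t. conv p (u t) x \<bullet> i)"
      by (simp cong: continuous_on_cong)
  qed
  have in_space: "\<exists>d>0. \<forall>x' t. t \<in> T \<longrightarrow> dist x' x < d \<longrightarrow> dist (conv p (u t) x') (conv p (u t) x) < e"
    if e: "0 < e" for x e
  proof -
    \<comment> \<open>No sign of \<open>M\<close> is assumed, hence the absolute value; adding 1
      makes \<open>C\<close> positive. The extra factor 1/2 in \<open>e / C / 2\<close> yields the
      strict inequality at the end.\<close>
    define C where "C = measure lebesgue (cball x (R + 1)) + \<bar>M\<bar> + 1"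
    have C: "0 < C" by (simp add: C_def add_nonneg_pos)
    have "uniformly_continuous_on UNIV p"
      by (rule uniformly_continuous_compact_support[OF cont supp])
    moreover have "0 < e / C / 2" using e C by simp
    ultimately obtain d where d: "0 < d" "\<And>z z'. dist z' z < d \<Longrightarrow> dist (p z') (p z) < e / C / 2"
      unfolding uniformly_continuous_on_def by (meson UNIV_I)
    have "dist (conv p (u t) x') (conv p (u t) x) < e" if t: "t \<in> T" and x': "dist x' x < min d 1" for x' t
    proof -
      define q where "q y = p (x' - y) - p (x - y)" for y
      have "dist (conv p (u t) x') (conv p (u t) x) = norm (LINT y|lebesgue. q y *\<^sub>R u t y)"
        using conv_integrable[OF u[OF t] cont supp, of R]
        by (simp add: conv_def q_def scaleR_diff_left dist_norm)
      also have "\<dots> \<le> e / C / 2 * (measure lebesgue (cball x (R + 1)) + energy (u t))"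
      proof (rule weighted_square_integrable(2)[OF u[OF t]])
        show "q \<in> borel_measurable borel"
          unfolding q_def
          by (intro borel_measurable_continuous_onI continuous_intros
              continuous_on_compose2[OF cont]) auto
        show "\<bar>q y\<bar> \<le> e / C / 2 * indicator (cball x (R + 1)) y" for y
        proof (cases "y \<in> cball x (R + 1)")
          case True
          then show ?thesis
            using d(2)[of "x' - y" "x - y"] x' by (simp add: q_def dist_norm)
        next
          case False
          then have "R + 1 < norm (x - y)" by (simp add: dist_norm)
          moreover have "norm (x - y) \<le> norm (x' - y) + dist x' x" by norm
          ultimately have "R < norm (x - y)" "R < norm (x' - y)"
            using x' by auto
          then show ?thesis
            using False supp by (simp add: q_def)
        qed
      qed (use e C in simp)
      also have "\<dots> \<le> e / C / 2 * C"
        using e C M[OF t] by (intro mult_left_mono) (auto simp: C_def)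
      also have "\<dots> < e" using C e by simp
      finally show ?thesis .
    qed
    with d(1) show ?thesis by (intro exI[of _ "min d 1"]) auto
  qed
  show ?thesis
    unfolding continuous_on_iff
  proof (intro ballI allI impI)
    fix z e assume z: "z \<in> (UNIV :: 'a set) \<times> T" and e: "(0::real) < e"
    obtain x t where [simp]: "z = (x, t)" and t: "t \<in> T" using z by auto
    obtain d1 where d1: "0 < d1"
      "\<And>x' t. t \<in> T \<Longrightarrow> dist x' x < d1 \<Longrightarrow> dist (conv p (u t) x') (conv p (u t) x) < e / 2"
      using in_space[of "e / 2" x] e by auto
    obtain d2 where d2: "0 < d2"
      "\<And>t'. t' \<in> T \<Longrightarrow> dist t' t < d2 \<Longrightarrow> dist (conv p (u t') x) (conv p (u t) x) < e / 2"
      using in_time[of x] t e unfolding continuous_on_iff by (meson half_gt_zero)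
    have "dist (conv p (u t') x') (conv p (u t) x) < e"
      if "t' \<in> T" "dist (x', t') (x, t) < min d1 d2" for x' t'
    proof -
      \<comment> \<open>The move from \<open>x'\<close> to \<open>x\<close> is made at the time
        \<open>t'\<close>, which is allowed because \<open>d1\<close> serves all times; the move
        from \<open>t'\<close> to \<open>t\<close> is then made at the fixed point
        \<open>x\<close>.\<close>
      have "dist x' x < d1" "dist t' t < d2"
        using that dist_fst_le[of "(x', t')" "(x, t)"] dist_snd_le[of "(x', t')" "(x, t)"] by auto
      with d1 d2 that(1) show ?thesis
        by (meson dist_triangle_half_l dist_commute_lessI)
    qed
    with d1(1) d2(1) show "\<exists>d>0. \<forall>x'\<in>UNIV \<times> T. dist x' z < d \<longrightarrow>
        dist (case x' of (x, t) \<Rightarrow> conv p (u t) x) (case z of (x, t) \<Rightarrow> conv p (u t) x) < e"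
      by (intro exI[of _ "min d1 d2"]) auto
  qed
qed

text \<open>The complement of the closed support is open and \<open>f\<close> vanishes on it, so
  uniqueness of the derivative applies. This makes the derivative kernels compactly
  supported.\<close>

lemma has_derivative_zero_outside_support:
  assumes der: "(f has_derivative f') (at z)" and z: "z \<notin> closure {z. f z \<noteq> 0}"
  shows "f' h = 0"
proof -
  have "f w = 0" if "w \<in> - closure {z. f z \<noteq> 0}" for w
    using that closure_subset[of "{z. f z \<noteq> 0}"] by auto
  with z have "((\<lambda>_. 0) has_derivative f') (at z)"
    by (intro has_derivative_transform_within_open[OF der open_Compl[OF closed_closure]])
       (simp_all only: Compl_iff not_False_eq_True)
  then have "f' = (\<lambda>_. 0)"
    by (rule has_derivative_unique) (rule has_derivative_const)
  then show ?thesis by simp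
qed

text \<open>All derivatives fall on the filter: each Jacobian entry is a component of the
  convolution of \<open>u t\<close> with a partial derivative of the rescaled filter, and the curl
  is a finite linear combination of such entries.\<close>

lemma curl_mollify_continuous:
  fixes u :: "'t::metric_space \<Rightarrow> real^3 \<Rightarrow> real^3"
  assumes \<phi>: "filter_profile \<phi>" and l: "0 < l"
    and u: "\<And>t. t \<in> T \<Longrightarrow> square_integrable (u t)"
    and M: "\<And>t. t \<in> T \<Longrightarrow> energy (u t) \<le> M"
    and weak: "\<And>w. square_integrable w \<Longrightarrow> continuous_on T (\<lambda>t. LINT y|lebesgue. u t y \<bullet> w y)"
  shows "continuous_on (UNIV \<times> T) (\<lambda>(x, t). curl (mollify \<phi> l (u t)) x)"
proof -
  define F where "F z = frechet_derivative \<phi> (at z)" for z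
  define \<psi> where "\<psi> z = \<phi> (z /\<^sub>R l) / l ^ 3" for z
  define D where "D z h = F (z /\<^sub>R l) (h /\<^sub>R l) / l ^ 3" for z h
  have "C_n 1 \<phi>" and supp: "closure {z. \<phi> z \<noteq> 0} \<subseteq> ball 0 1"
    using \<phi> unfolding filter_profile_def test_function_def by blast+
  then have F: "(\<phi> has_derivative F z) (at z)"
    and contF: "e \<in> Basis \<Longrightarrow> continuous_on UNIV (\<lambda>z. F z e)" for z e
    unfolding F_def by (auto simp: frechet_derivative_works)
  have linF: "linear (F z)" for z
    using F has_derivative_linear by blast
  \<comment> \<open>\<open>C_n\<close> controls the derivative along basis vectors only; linearity
    of \<open>F z\<close> extends the continuity to every direction.\<close>
  have contF': "continuous_on UNIV (\<lambda>z. F z h)" for h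
  proof -
    have "F z h = (\<Sum>i\<in>Basis. (h \<bullet> i) * F z i)" for z
      by (subst euclidean_representation[of h, symmetric])
         (simp add: linear_sum[OF linF] linear_scale[OF linF])
    then show ?thesis
      by (simp add: contF continuous_on_sum continuous_on_mult_left)
  qed
  have der: "(\<psi> has_derivative D z) (at z)" for z
    unfolding \<psi>_def D_def divide_inverse
    by (intro has_derivative_mult_left has_derivative_compose[OF _ F]
        has_derivative_scaleR_right has_derivative_ident)
  have contD: "continuous_on UNIV (\<lambda>z. D z h)" for h
    unfolding D_def using l
    by (intro continuous_intros continuous_on_compose2[OF contF']) auto
  have scale: "1 < norm (z /\<^sub>R l)" if "l < norm z" for z :: "real^3"
    using that l by (simp add: field_simps)
  have supp\<psi>: "\<psi> z = 0" if "l < norm z" for z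
  proof -
    have "z /\<^sub>R l \<notin> closure {z. \<phi> z \<noteq> 0}" using scale[OF that] supp by force
    then have "\<phi> (z /\<^sub>R l) = 0" using closure_subset[of "{z. \<phi> z \<noteq> 0}"] by auto
    then show ?thesis by (simp add: \<psi>_def)
  qed
  have suppD: "D z h = 0" if "l < norm z" for z h
  proof -
    have "z /\<^sub>R l \<notin> closure {z. \<phi> z \<noteq> 0}" using scale[OF that] supp by force
    from has_derivative_zero_outside_support[OF F this] show ?thesis by (simp add: D_def)
  qed
  have mollify_eq: "mollify \<phi> l v = conv \<psi> v" for v
    by (simp add: mollify_def conv_def \<psi>_def fun_eq_iff)
  have jac: "jacobian (mollify \<phi> l (u t)) (at x) $ i $ j = conv (\<lambda>z. D z (axis j 1)) (u t) x $ i"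
    if "t \<in> T" for t x i j
  proof -
    have "(mollify \<phi> l (u t) has_derivative (\<lambda>h. conv (\<lambda>z. D z h) (u t) x)) (at x)"
      unfolding mollify_eq
      by (rule conv_has_derivative[OF u[OF that] der contD supp\<psi> suppD])
    from frechet_derivative_at[OF this, symmetric] show ?thesis
      by (simp add: jacobian_def matrix_def)
  qed
  have "continuous_on (UNIV \<times> T) (\<lambda>(x, t). conv (\<lambda>z. D z h) (u t) x)" for h
    by (rule conv_jointly_continuous[OF u M weak contD suppD])
  then have "continuous_on (UNIV \<times> T) (\<lambda>z. \<chi> i. \<Sum>j\<in>UNIV. \<Sum>k\<in>UNIV. levi_civita i j k *
      conv (\<lambda>z. D z (axis j 1)) (u (snd z)) (fst z) $ k)"
    unfolding case_prod_unfold by (intro continuous_intros)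
  then show ?thesis
    by (rule continuous_on_eq) (auto simp: curl_def jac)
qed

lemma filtered_vorticity_continuous:
  assumes lh: "leray_hopf a b u" and \<phi>: "filter_profile \<phi>" and \<sigma>: "0 < \<sigma>"
  shows "continuous_on (UNIV \<times> {a..<b}) (\<lambda>(x, t). filtered_vorticity \<phi> \<sigma> u k t x)"
proof -
  have u: "square_integrable (u t)" if "t \<in> {a..<b}" for t
    using lh that unfolding leray_hopf_def by blast
  have weak: "continuous_on {a..<b} (\<lambda>t. LINT y|lebesgue. u t y \<bullet> w y)" if "square_integrable w" for w
    using lh that unfolding leray_hopf_def by blast
  obtain M where M: "\<forall>t\<in>{a..<b}. (\<integral>\<^sup>+x. ennreal ((norm (u t x))\<^sup>2) \<partial>lebesgue) \<le> ennreal M"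
    using lh unfolding leray_hopf_def by blast
  \<comment> \<open>\<open>ennreal\<close> sends negative reals to 0, so the real bound has to be
    \<open>max 0 M\<close>.\<close>
  have "energy (u t) \<le> max 0 M" if "t \<in> {a..<b}" for t
  proof -
    have "ennreal (energy (u t)) = (\<integral>\<^sup>+x. ennreal ((norm (u t x))\<^sup>2) \<partial>lebesgue)"
      unfolding energy_def
      by (rule nn_integral_eq_integral[symmetric])
         (auto intro: square_integrable_integrable[OF u[OF that]])
    also have "\<dots> \<le> ennreal (max 0 M)"
      using M that by (intro order_trans[OF bspec[OF M that] ennreal_leI]) auto
    finally show ?thesis by (simp add: ennreal_le_iff)
  qed
  moreover have "0 < \<sigma> * rad k" using \<sigma> by (simp add: rad_def)
  ultimately show ?thesis
    unfolding filtered_vorticity_def by (intro curl_mollify_continuous[OF \<phi> _ u _ weak])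
qed

section \<open>The strain kernel\<close>

lemma abs_levi_civita_le: "\<bar>levi_civita i j k\<bar> \<le> 1"
  by (simp add: levi_civita_def)

text \<open>The kernel is homogeneous of degree -3. Bounding each of the six products by the squared
  norm gives the constant 18 / (8 pi), which is below 1 since pi exceeds 3.\<close>

lemma abs_strain_kernel_le:
  assumes "z \<noteq> 0"
  shows "\<bar>strain_kernel i j m z\<bar> \<le> 1 / norm z ^ 3"
proof -
  have prod: "\<bar>z $ i * levi_civita j k m * z $ k\<bar> \<le> (norm z)\<^sup>2" for i j k
  proof -
    have "\<bar>z $ i\<bar> * \<bar>levi_civita j k m\<bar> * \<bar>z $ k\<bar> \<le> norm z * 1 * norm z"
      by (intro mult_mono component_le_norm_cart abs_levi_civita_le) auto
    then show ?thesis by (simp add: abs_mult power2_eq_square)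
  qed
  have "\<bar>\<Sum>k\<in>UNIV. z $ j * levi_civita i k m * z $ k + z $ i * levi_civita j k m * z $ k\<bar>
      \<le> (\<Sum>k\<in>(UNIV::3 set). 2 * (norm z)\<^sup>2)"
    unfolding mult_2
    by (intro order_trans[OF sum_abs] sum_mono order_trans[OF abs_triangle_ineq] add_mono prod)
  also have "\<dots> = 6 * (norm z)\<^sup>2" by simp
  finally have "\<bar>strain_kernel i j m z\<bar> \<le> 3 / (8 * pi * norm z ^ 5) * (6 * (norm z)\<^sup>2)"
    unfolding strain_kernel_def abs_mult by (intro mult_mono) auto
  also have "\<dots> = (18 / (8 * pi)) * (1 / norm z ^ 3)"
    using assms by (simp add: field_simps eval_nat_numeral)
  also have "\<dots> \<le> 1 * (1 / norm z ^ 3)"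
    using pi_gt3 by (intro mult_right_mono) (auto simp: field_simps)
  finally show ?thesis by simp
qed

text \<open>The factor 27 counts nine entries with three summands each.\<close>

lemma norm_strain_tensor_le:
  assumes "z \<noteq> 0"
  shows "norm (strain_tensor z \<omega>) \<le> 27 / norm z ^ 3 * norm \<omega>"
proof -
  have "\<bar>\<Sum>m\<in>UNIV. strain_kernel i j m z * \<omega> $ m\<bar> \<le> (\<Sum>m\<in>(UNIV::3 set). 1 / norm z ^ 3 * norm \<omega>)" for i j
    by (intro order_trans[OF sum_abs] sum_mono)
       (simp only: abs_mult, intro mult_mono abs_strain_kernel_le[OF assms] component_le_norm_cart, auto)
  then have entry: "\<bar>strain_tensor z \<omega> $ i $ j\<bar> \<le> 3 / norm z ^ 3 * norm \<omega>" for i j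
    by (simp add: strain_tensor_def)
  have "norm (strain_tensor z \<omega>) \<le> (\<Sum>i\<in>UNIV. norm (strain_tensor z \<omega> $ i))"
    by (simp add: norm_vec_def L2_set_le_sum)
  also have "\<dots> \<le> (\<Sum>i\<in>UNIV. \<Sum>j\<in>UNIV. \<bar>strain_tensor z \<omega> $ i $ j\<bar>)"
    by (intro sum_mono norm_le_l1_cart)
  also have "\<dots> \<le> (\<Sum>i\<in>(UNIV::3 set). \<Sum>j\<in>(UNIV::3 set). 3 / norm z ^ 3 * norm \<omega>)"
    by (intro sum_mono entry)
  finally show ?thesis by simp
qed

text \<open>The \<open>norm\<close> of a matrix is here the Frobenius norm, so Cauchy-Schwarz on
  each row suffices.\<close>

lemma norm_matrix_vector_mult_le:
  fixes A :: "real^'n^'m"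
  shows "norm (A *v x) \<le> norm A * norm x"
proof -
  have "norm (A *v x) \<le> L2_set (\<lambda>i. norm (A $ i) * norm x) UNIV"
    unfolding norm_vec_def[of "A *v x"]
    by (intro L2_set_mono) (auto simp: matrix_vector_mul_component Cauchy_Schwarz_ineq2)
  also have "\<dots> = norm A * norm x"
    by (simp add: L2_set_left_distrib norm_vec_def[of A])
  finally show ?thesis .
qed

section \<open>Integrals in the extended nonnegative reals\<close>

lemma ennreal_sqrt_ennreal: "0 \<le> r \<Longrightarrow> ennreal_sqrt (ennreal r) = ennreal (sqrt r)"
  by (simp add: ennreal_sqrt_def)

lemma ennreal_sqrt_top [simp]: "ennreal_sqrt top = top"
  by (simp add: ennreal_sqrt_def)

lemma ennreal_sqrt_power2 [simp]: "(ennreal_sqrt a)\<^sup>2 = a"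
  by (cases a) (auto simp: ennreal_sqrt_ennreal ennreal_power)

lemma ennreal_sqrt_mono: "a \<le> b \<Longrightarrow> ennreal_sqrt a \<le> ennreal_sqrt b"
  by (cases a; cases b) (auto simp: ennreal_sqrt_ennreal top_unique)

lemma ennreal_sqrt_of_power2 [simp]: "ennreal_sqrt (a\<^sup>2) = a"
  by (cases a) (auto simp: ennreal_sqrt_ennreal ennreal_power)

text \<open>Squaring and \<open>ennreal_sqrt\<close> are mutually inverse on all of the extended
  half-line, so the infinite values and the product of 0 with infinity need no separate
  cases.\<close>

lemma ennreal_sqrt_mult: "ennreal_sqrt (a * b) = ennreal_sqrt a * ennreal_sqrt b"
  by (metis ennreal_sqrt_of_power2 ennreal_sqrt_power2 power_mult_distrib)

lemma ennreal_sqrt_measurable [measurable]: "ennreal_sqrt \<in> borel_measurable borel"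
  unfolding ennreal_sqrt_def by measurable

lemma nn_integral_Cauchy_Schwarz:
  assumes "f \<in> borel_measurable M" "g \<in> borel_measurable M"
  shows "(\<integral>\<^sup>+x. f x * g x \<partial>M) \<le> ennreal_sqrt (\<integral>\<^sup>+x. (f x)\<^sup>2 \<partial>M) * ennreal_sqrt (\<integral>\<^sup>+x. (g x)\<^sup>2 \<partial>M)"
  using ennreal_sqrt_mono[OF Cauchy_Schwarz_nn_integral[OF assms]] by (simp add: ennreal_sqrt_mult)

text \<open>Completion leaves nonnegative integrals unchanged; Borel measurability then permits
  Tonelli, with time as the outer variable.\<close>

lemma nn_integral_lebesgue_pair:
  fixes f :: "'a::euclidean_space \<times> 'b::euclidean_space \<Rightarrow> ennreal"
  assumes "f \<in> borel_measurable borel"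
  shows "(\<integral>\<^sup>+z. f z \<partial>lebesgue) = (\<integral>\<^sup>+t. \<integral>\<^sup>+x. f (x, t) \<partial>lborel \<partial>lborel)"
  using lborel_pair.nn_integral_snd[of f] assms
  by (simp add: nn_integral_completion lborel_prod)

text \<open>A nonintegrable \<open>f\<close> is covered too, since its Bochner integral is 0 by
  convention. The shell strain can thus be estimated directly.\<close>

lemma norm_integral_le_nn_integral:
  fixes f :: "'a \<Rightarrow> 'b::{banach, second_countable_topology}"
  shows "ennreal (norm (LINT x|M. f x)) \<le> (\<integral>\<^sup>+x. ennreal (norm (f x)) \<partial>M)"
  using integral_norm_bound_ennreal[of M f]
  by (cases "integrable M f") (auto simp: not_integrable_integral_eq)

section \<open>Shell estimates\<close>

text \<open>The shell has radii proportional to \<open>2 ^ m * rad k = rad (k - m)\<close>. Moving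
  its centre from \<open>x\<close> to \<open>x0\<close> costs less than \<open>rad k\<close>, hence
  less than one unit of \<open>rad (k - m)\<close>, which accounts for the -1 and +1 in the
  annulus.\<close>

lemma shell_subset_reservoir_annulus:
  assumes "x \<in> ball x0 (rad k)" "m \<le> k"
  shows "shell \<Gamma> k m x \<subseteq> reservoir_annulus \<Gamma> x0 (k - m)"
proof -
  have r: "2 ^ m * rad k = rad (k - m)"
    using assms(2) by (simp add: rad_def power_diff field_simps)
  have le: "rad k \<le> rad (k - m)"
    by (simp add: rad_def power_decreasing)
  have d: "norm (x - x0) < rad k"
    using assms(1) by (simp add: dist_norm norm_minus_commute)
  have "(\<Gamma> - 1) * rad (k - m) < norm (y - x0) \<and> norm (y - x0) \<le> (2 * \<Gamma> + 1) * rad (k - m)"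
    if "y \<in> shell \<Gamma> k m x" for y
  proof -
    have "\<Gamma> * rad (k - m) < norm (x - y)" "norm (x - y) \<le> 2 * \<Gamma> * rad (k - m)"
      using that by (auto simp: shell_def mult.assoc r)
    moreover have "norm (x - y) \<le> norm (x - x0) + norm (y - x0)"
      "norm (y - x0) \<le> norm (x - x0) + norm (x - y)" by norm+
    ultimately show ?thesis using d le by (simp add: algebra_simps)
  qed
  then show ?thesis by (auto simp: reservoir_annulus_def)
qed

lemma borel_reservoir_annulus [measurable]: "reservoir_annulus \<Gamma> x0 j \<in> sets borel"
  unfolding reservoir_annulus_def by measurable

lemma emeasure_reservoir_annulus_le:
  assumes "0 \<le> \<Gamma>"
  shows "emeasure lborel (reservoir_annulus \<Gamma> x0 j)
    \<le> ennreal (unit_ball_vol 3 * ((2 * \<Gamma> + 1) * rad j) ^ 3)"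
proof -
  have "emeasure lborel (reservoir_annulus \<Gamma> x0 j) \<le> emeasure lborel (cball x0 ((2 * \<Gamma> + 1) * rad j))"
    by (intro emeasure_mono) (auto simp: reservoir_annulus_def dist_norm norm_minus_commute)
  also have "\<dots> = ennreal (unit_ball_vol 3 * ((2 * \<Gamma> + 1) * rad j) ^ 3)"
    using assms by (subst emeasure_cball) (auto simp: rad_def)
  finally show ?thesis .
qed

text \<open>The two factors of the constant are the kernel bound at the inner radius of the shell
  and the square root of the volume of a ball containing the annulus. The right-hand side is
  independent of \<open>x\<close>.\<close>

lemma norm_shell_strain_le:
  assumes "0 < \<Gamma>" "x \<in> ball x0 (rad k)" "m \<le> k"
    and cont: "continuous_on UNIV (filtered_vorticity \<phi> \<sigma> u k t)"
  shows "ennreal (norm (shell_strain \<Gamma> \<phi> \<sigma> u k m t x)) \<le>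
    ennreal (27 / (\<Gamma> * rad (k - m)) ^ 3 * sqrt (unit_ball_vol 3 * ((2 * \<Gamma> + 1) * rad (k - m)) ^ 3)) *
    ennreal_sqrt (\<integral>\<^sup>+y\<in>reservoir_annulus \<Gamma> x0 (k - m).
       ennreal ((norm (filtered_vorticity \<phi> \<sigma> u k t y))\<^sup>2) \<partial>lborel)"
proof -
  define \<omega> where "\<omega> = filtered_vorticity \<phi> \<sigma> u k t"
  define A where "A = reservoir_annulus \<Gamma> x0 (k - m)"
  define c where "c = 27 / (\<Gamma> * rad (k - m)) ^ 3"
  have [measurable]: "\<omega> \<in> borel_measurable borel"
    unfolding \<omega>_def by (rule borel_measurable_continuous_onI[OF cont])
  have [measurable]: "A \<in> sets borel" by (simp add: A_def)
  have rad_pos: "0 < rad i" for i by (simp add: rad_def)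
  have c: "0 \<le> c" using rad_pos[of "k - m"] assms(1) by (simp add: c_def)
  have r: "2 ^ m * rad k = rad (k - m)"
    using assms(3) by (simp add: rad_def power_diff field_simps)
  have bd: "norm (indicator (shell \<Gamma> k m x) y *\<^sub>R strain_tensor (x - y) (\<omega> y))
      \<le> c * (norm (\<omega> y) * indicator A y)" for y
  proof (cases "y \<in> shell \<Gamma> k m x")
    case True
    then have yA: "y \<in> A" using shell_subset_reservoir_annulus[OF assms(2,3)] by (auto simp: A_def)
    have lt: "\<Gamma> * rad (k - m) < norm (x - y)"
      using True by (simp add: shell_def mult.assoc r)
    have pos: "0 < \<Gamma> * rad (k - m)" using rad_pos assms(1) by simp
    have "norm (strain_tensor (x - y) (\<omega> y)) \<le> 27 / norm (x - y) ^ 3 * norm (\<omega> y)"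
      using lt pos by (intro norm_strain_tensor_le) auto
    also have "\<dots> \<le> c * norm (\<omega> y)"
      unfolding c_def
      by (intro mult_right_mono divide_left_mono power_mono less_imp_le[OF lt] less_imp_le[OF pos]
          pos order.strict_trans[OF pos lt] zero_less_power mult_pos_pos[of "_ ^ 3" "_ ^ 3"]) auto
    finally show ?thesis using True yA by simp
  qed (use c in simp)
  have "ennreal (norm (shell_strain \<Gamma> \<phi> \<sigma> u k m t x)) \<le>
      (\<integral>\<^sup>+y. ennreal (c * (norm (\<omega> y) * indicator A y)) \<partial>lborel)"
    unfolding shell_strain_def set_lebesgue_integral_def \<omega>_def[symmetric]
    by (rule order_trans[OF norm_integral_le_nn_integral])
       (unfold nn_integral_completion, intro nn_integral_mono ennreal_leI bd)
  \<comment> \<open>The indicator is written twice so that one copy can be the second factor in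
    Cauchy-Schwarz, contributing the volume of \<open>A\<close>.\<close>
  also have "\<dots> = ennreal c * (\<integral>\<^sup>+y. (ennreal (norm (\<omega> y)) * indicator A y) * indicator A y \<partial>lborel)"
    using c by (subst nn_integral_cmult[symmetric])
      (auto simp: ennreal_mult' indicator_def intro!: nn_integral_cong)
  also have "\<dots> \<le> ennreal c * (ennreal_sqrt (\<integral>\<^sup>+y. (ennreal (norm (\<omega> y)) * indicator A y)\<^sup>2 \<partial>lborel) *
      ennreal_sqrt (\<integral>\<^sup>+y. (indicator A y)\<^sup>2 \<partial>lborel))"
    by (intro mult_left_mono nn_integral_Cauchy_Schwarz) auto
  also have "(\<integral>\<^sup>+y. (ennreal (norm (\<omega> y)) * indicator A y)\<^sup>2 \<partial>lborel) =
      (\<integral>\<^sup>+y\<in>A. ennreal ((norm (\<omega> y))\<^sup>2) \<partial>lborel)"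
    by (intro nn_integral_cong) (auto simp: indicator_def ennreal_power)
  also have "(\<integral>\<^sup>+y. (indicator A y)\<^sup>2 \<partial>lborel) = emeasure lborel A"
  proof -
    have "(\<integral>\<^sup>+y. (indicator A y)\<^sup>2 \<partial>lborel) = (\<integral>\<^sup>+y. indicator A y \<partial>lborel)"
      by (intro nn_integral_cong) (simp split: split_indicator)
    then show ?thesis by simp
  qed
  also have "ennreal c * (ennreal_sqrt (\<integral>\<^sup>+y\<in>A. ennreal ((norm (\<omega> y))\<^sup>2) \<partial>lborel) * ennreal_sqrt (emeasure lborel A))
      \<le> ennreal c * (ennreal_sqrt (\<integral>\<^sup>+y\<in>A. ennreal ((norm (\<omega> y))\<^sup>2) \<partial>lborel) *
          ennreal (sqrt (unit_ball_vol 3 * ((2 * \<Gamma> + 1) * rad (k - m)) ^ 3)))"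
    using ennreal_sqrt_mono[OF emeasure_reservoir_annulus_le, of \<Gamma> x0 "k - m"] assms(1) rad_pos[of "k - m"]
    by (intro mult_left_mono) (auto simp: A_def ennreal_sqrt_ennreal)
  finally show ?thesis
    unfolding c_def[symmetric] A_def[symmetric] \<omega>_def[symmetric]
    using c assms(1) rad_pos[of "k - m"] by (simp add: ennreal_mult' ac_simps)
qed

text \<open>The bound is nonnegative, so it also controls the positive part. It separates the strain
  from the weight \<open>a * (norm \<omega>)\<^sup>2\<close>, which is the density inside
  \<open>local_quartic\<close>.\<close>

lemma stretching_le:
  fixes A :: "real^'n^'n"
  assumes "0 \<le> a"
  shows "ennreal (a * max 0 (((\<Sum>m\<in>I. S m) *v \<omega>) \<bullet> \<omega>)) \<le>
    (\<Sum>m\<in>I. ennreal (norm (S m :: real^'n^'n))) * ennreal (a * (norm \<omega>)\<^sup>2)"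
proof -
  have "((\<Sum>m\<in>I. S m) *v \<omega>) \<bullet> \<omega> \<le> norm ((\<Sum>m\<in>I. S m) *v \<omega>) * norm \<omega>"
    by (rule norm_cauchy_schwarz)
  also have "\<dots> \<le> (norm (\<Sum>m\<in>I. S m) * norm \<omega>) * norm \<omega>"
    by (intro mult_right_mono norm_matrix_vector_mult_le) auto
  also have "\<dots> \<le> ((\<Sum>m\<in>I. norm (S m)) * norm \<omega>) * norm \<omega>"
    by (intro mult_right_mono norm_sum) auto
  finally have "max 0 (((\<Sum>m\<in>I. S m) *v \<omega>) \<bullet> \<omega>) \<le> (\<Sum>m\<in>I. norm (S m)) * (norm \<omega>)\<^sup>2"
    by (simp add: power2_eq_square sum_nonneg mult.assoc)
  from mult_left_mono[OF this assms]
  have "a * max 0 (((\<Sum>m\<in>I. S m) *v \<omega>) \<bullet> \<omega>) \<le> (\<Sum>m\<in>I. norm (S m)) * (a * (norm \<omega>)\<^sup>2)"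
    by (simp add: mult.left_commute)
  then have "ennreal (a * max 0 (((\<Sum>m\<in>I. S m) *v \<omega>) \<bullet> \<omega>)) \<le>
      ennreal ((\<Sum>m\<in>I. norm (S m)) * (a * (norm \<omega>)\<^sup>2))"
    by (rule ennreal_leI)
  then show ?thesis
    using assms by (simp add: ennreal_mult sum_nonneg)
qed

text \<open>The triangle of pairs with \<open>j\<close> at most \<open>k\<close> is reparametrized
  by \<open>(k, j)\<close> going to \<open>(j, k - j)\<close>, so that sums over scales become sums
  over reservoirs.\<close>

lemma sum_triangle_diagonals:
  fixes f :: "nat \<Rightarrow> nat \<Rightarrow> 'a::comm_monoid_add"
  shows "(\<Sum>k=0..N. \<Sum>j=0..k. f j k) = (\<Sum>j=0..N. \<Sum>m=0..N - j. f j (j + m))"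
  by (simp add: sum.Sigma,
      rule sum.reindex_bij_witness[of _ "\<lambda>(j, m). (j + m, j)" "\<lambda>(k, j). (j, k - j)"]) auto

text \<open>This is what remains of the constant in \<open>norm_shell_strain_le\<close> once the
  powers of the radius are taken out.\<close>

definition far_const :: "real \<Rightarrow> real" where
  "far_const \<Gamma> = 27 / \<Gamma> ^ 3 * sqrt (unit_ball_vol 3 * (2 * \<Gamma> + 1) ^ 3)"

section \<open>From the shell bounds to the space-time estimate\<close>

lemma cutoff_measurable:
  assumes "cutoff_profile \<eta>"
  shows "(\<lambda>z. cutoff \<eta> x0 t0 k (fst z) (snd z)) \<in> borel_measurable borel"
proof -
  have "C_n 0 \<eta>" using assms unfolding cutoff_profile_def test_function_def by blast
  then have "continuous_on UNIV \<eta>" by simp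
  then have "continuous_on UNIV (\<lambda>z. cutoff \<eta> x0 t0 k (fst z) (snd z))"
    unfolding cutoff_def
    by (rule continuous_on_compose2) (auto simp: rad_def intro!: continuous_intros)
  then show ?thesis by (rule borel_measurable_continuous_onI)
qed

text \<open>Power counting in \<open>rad j\<close>: -3 from the kernel, 3/2 from the volume and 1/2
  from the normalization of the reservoir add up to -1, and \<open>rad k / rad j\<close> is the
  geometric decay.\<close>

lemma shell_constant_eq:
  assumes "0 < \<Gamma>" "j \<le> k"
  shows "rad k * (27 / (\<Gamma> * rad j) ^ 3 * sqrt (unit_ball_vol 3 * ((2 * \<Gamma> + 1) * rad j) ^ 3)) * sqrt (rad j)
    = far_const \<Gamma> * (1 / 2) ^ (k - j)"
proof -
  have pos: "0 < rad j" by (simp add: rad_def)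
  have "sqrt (rad j ^ 3) * sqrt (rad j) = sqrt (rad j ^ 3 * rad j)"
    by (simp add: real_sqrt_mult)
  also have "rad j ^ 3 * rad j = (rad j ^ 2) ^ 2"
    by (simp add: eval_nat_numeral)
  also have "sqrt ((rad j ^ 2) ^ 2) = rad j ^ 2"
    by (rule real_sqrt_unique) simp_all
  finally have "sqrt (rad j ^ 3) * sqrt (rad j) = rad j ^ 2" .
  then have "sqrt (unit_ball_vol 3 * ((2 * \<Gamma> + 1) * rad j) ^ 3) * sqrt (rad j)
      = sqrt (unit_ball_vol 3 * (2 * \<Gamma> + 1) ^ 3) * rad j ^ 2"
    by (simp add: power_mult_distrib real_sqrt_mult mult.assoc)
  then have "rad k * (27 / (\<Gamma> * rad j) ^ 3 * sqrt (unit_ball_vol 3 * ((2 * \<Gamma> + 1) * rad j) ^ 3)) * sqrt (rad j)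
      = rad k * (27 / (\<Gamma> * rad j) ^ 3 * (sqrt (unit_ball_vol 3 * (2 * \<Gamma> + 1) ^ 3) * rad j ^ 2))"
    by (simp only: mult.assoc)
  also have "\<dots> = far_const \<Gamma> * (rad k / rad j)"
    using pos assms(1) by (simp add: far_const_def field_simps eval_nat_numeral)
  also have "rad k / rad j = (1 / 2) ^ (k - j)"
    using assms(2) by (simp add: rad_def power_diff)
  finally show ?thesis .
qed

text \<open>\<open>N\<close> stands for the squared filtered vorticity cut to zero outside the time
  interval, a Borel function on all of space-time, so that Tonelli applies to it.\<close>

lemma reservoir_at_eq:
  fixes N :: "(real^3) \<times> real \<Rightarrow> ennreal"
  assumes "N \<in> borel_measurable borel"
    and N: "\<And>x t. t \<in> time_int t0 k \<Longrightarrow> N (x, t) = ennreal ((norm (filtered_vorticity \<phi> \<sigma> u k t x))\<^sup>2)"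
    and N0: "\<And>x t. t \<notin> time_int t0 k \<Longrightarrow> N (x, t) = 0"
  shows "reservoir_at \<Gamma> \<phi> \<sigma> x0 t0 u j k =
    ennreal_sqrt (ennreal (1 / rad j) * (\<integral>\<^sup>+t. (\<integral>\<^sup>+x\<in>reservoir_annulus \<Gamma> x0 j. N (x, t) \<partial>lborel) \<partial>lborel))"
proof -
  define f where "f z = N z * indicator (reservoir_annulus \<Gamma> x0 j) (fst z)" for z
  have "f \<in> borel_measurable (borel \<Otimes>\<^sub>M borel)"
    unfolding f_def using assms(1) by (simp add: borel_prod[symmetric])
  then have f: "f \<in> borel_measurable borel" by (simp add: borel_prod)
  have "(\<integral>\<^sup>+(x, t)\<in>reservoir_annulus \<Gamma> x0 j \<times> time_int t0 k.
        ennreal ((norm (filtered_vorticity \<phi> \<sigma> u k t x))\<^sup>2) \<partial>lebesgue) = (\<integral>\<^sup>+z. f z \<partial>lebesgue)"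
    using N0 by (intro nn_integral_cong) (fastforce simp: f_def N indicator_def)
  also have "\<dots> = (\<integral>\<^sup>+t. (\<integral>\<^sup>+x\<in>reservoir_annulus \<Gamma> x0 j. N (x, t) \<partial>lborel) \<partial>lborel)"
    by (subst nn_integral_lebesgue_pair[OF f]) (simp add: f_def)
  finally show ?thesis by (simp add: reservoir_at_def)
qed

lemma local_quartic_eq:
  fixes N :: "(real^3) \<times> real \<Rightarrow> ennreal"
  assumes \<eta>: "cutoff_profile \<eta>"
    and N: "\<And>x t. t \<in> time_int t0 k \<Longrightarrow> N (x, t) = ennreal ((norm (filtered_vorticity \<phi> \<sigma> u k t x))\<^sup>2)"
    and N0: "\<And>x t. t \<notin> time_int t0 k \<Longrightarrow> N (x, t) = 0"
  shows "local_quartic \<eta> \<phi> \<sigma> x0 t0 u k = ennreal_sqrt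
    (\<integral>\<^sup>+t. (\<integral>\<^sup>+x\<in>ball x0 (2 * rad k). ennreal (cutoff \<eta> x0 t0 k x t) * N (x, t) \<partial>lborel)\<^sup>2 \<partial>lborel)"
proof -
  have \<eta>0: "0 \<le> cutoff \<eta> x0 t0 k x t" for x t
    using \<eta> by (simp add: cutoff_profile_def cutoff_def)
  show ?thesis
    unfolding local_quartic_def nn_integral_completion
    by (intro arg_cong[where f = ennreal_sqrt] nn_integral_cong)
       (auto simp: N N0 indicator_def ennreal_mult \<eta>0)
qed

text \<open>The strain bound depends on time alone, so the spatial integral only meets the weighted
  enstrophy. What remains is an integral in time of \<open>ennreal_sqrt (E j t) * H t\<close>, to
  which Cauchy-Schwarz applies.\<close>

lemma mu_far_ann_le:
  assumes \<Gamma>: "1 < \<Gamma>" and \<eta>: "cutoff_profile \<eta>"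
    and cont: "continuous_on (UNIV \<times> time_int t0 k) (\<lambda>(x, t). filtered_vorticity \<phi> \<sigma> u k t x)"
  shows "mu_far_ann \<Gamma> \<eta> \<phi> \<sigma> x0 t0 u k
    \<le> ennreal (far_const \<Gamma>) * (\<Sum>j=0..k. ennreal ((1 / 2) ^ (k - j)) *
         reservoir_at \<Gamma> \<phi> \<sigma> x0 t0 u j k * local_quartic \<eta> \<phi> \<sigma> x0 t0 u k)"
proof -
  define \<Omega> where "\<Omega> = filtered_vorticity \<phi> \<sigma> u k"
  define I where "I = time_int t0 k"
  define A where "A j = reservoir_annulus \<Gamma> x0 j" for j
  define Q where "Q = local_quartic \<eta> \<phi> \<sigma> x0 t0 u k"
  \<comment> \<open>Continuity is known on the time slab only; the indicator extends the vorticity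
    by zero to a function that is Borel on the whole space.\<close>
  define N where "N z = ennreal ((norm (indicator (UNIV \<times> I) z *\<^sub>R (case z of (x, t) \<Rightarrow> \<Omega> t x)))\<^sup>2)"
    for z :: "(real^3) \<times> real"
  define B where "B = ball x0 (2 * rad k)"
  define X where "X z = ennreal (cutoff \<eta> x0 t0 k (fst z) (snd z))" for z :: "(real^3) \<times> real"
  define E where "E j t = (\<integral>\<^sup>+x\<in>A j. N (x, t) \<partial>lborel)" for j t
  define H where "H t = (\<integral>\<^sup>+x\<in>B. X (x, t) * N (x, t) \<partial>lborel)" for t
  define c where "c j = 27 / (\<Gamma> * rad j) ^ 3 * sqrt (unit_ball_vol 3 * ((2 * \<Gamma> + 1) * rad j) ^ 3)" for j
  have rad_pos: "0 < rad i" for i by (simp add: rad_def)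
  have c: "0 \<le> c j" for j
    using \<Gamma> rad_pos[of j] by (simp add: c_def)
  have \<eta>0: "0 \<le> cutoff \<eta> x0 t0 k x t" for x t
    using \<eta> by (simp add: cutoff_profile_def cutoff_def)
  have "UNIV \<times> I \<in> sets (borel :: ((real^3) \<times> real) measure)"
    by (intro borel_open open_Times) (auto simp: I_def time_int_def)
  then have "(\<lambda>z. indicator (UNIV \<times> I) z *\<^sub>R (case z of (x, t) \<Rightarrow> \<Omega> t x)) \<in> borel_measurable borel"
    using cont unfolding I_def \<Omega>_def by (rule borel_measurable_continuous_on_indicator)
  then have Nb: "N \<in> borel_measurable borel"
    unfolding N_def by measurable
  have Xb: "X \<in> borel_measurable borel"
    using cutoff_measurable[OF \<eta>] unfolding X_def by measurable
  have Nm [measurable]: "N \<in> borel_measurable (borel \<Otimes>\<^sub>M borel)"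
    and Xm [measurable]: "X \<in> borel_measurable (borel \<Otimes>\<^sub>M borel)"
    using Nb Xb by (simp_all add: borel_prod)
  have [measurable]: "A j \<in> sets borel" for j by (simp add: A_def)
  have [measurable]: "B \<in> sets borel" by (simp add: B_def)
  have E_meas [measurable]: "E j \<in> borel_measurable borel" for j
    unfolding E_def by measurable
  have H_meas [measurable]: "H \<in> borel_measurable borel"
    unfolding H_def by measurable
  have N: "N (x, t) = ennreal ((norm (\<Omega> t x))\<^sup>2)" if "t \<in> I" for x t
    using that by (simp add: N_def)
  have N0: "N (x, t) = 0" if "t \<notin> I" for x t
    using that by (simp add: N_def)
  have R_eq: "reservoir_at \<Gamma> \<phi> \<sigma> x0 t0 u j k = ennreal_sqrt (ennreal (1 / rad j) * (\<integral>\<^sup>+t. E j t \<partial>lborel))" for j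
    unfolding E_def A_def
    by (rule reservoir_at_eq[OF Nb N[unfolded I_def \<Omega>_def] N0[unfolded I_def]])
  have Q_eq: "Q = ennreal_sqrt (\<integral>\<^sup>+t. (H t)\<^sup>2 \<partial>lborel)"
    unfolding Q_def H_def X_def B_def fst_conv snd_conv
    by (rule local_quartic_eq[OF \<eta> N[unfolded I_def \<Omega>_def] N0[unfolded I_def]])
  have pointwise: "(let \<omega> = \<Omega> t x in
         ennreal (cutoff \<eta> x0 t0 k x t *
           max 0 (((\<Sum>m=0..k. shell_strain \<Gamma> \<phi> \<sigma> u k m t x) *v \<omega>) \<bullet> \<omega>))) * indicator (cyl x0 t0 k) (x, t)
      \<le> (\<Sum>m=0..k. ennreal (c (k - m)) * (ennreal_sqrt (E (k - m) t) *
            (X (x, t) * N (x, t) * indicator (B) x)))"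
    (is "?L \<le> ?R") for x t
  proof (cases "(x, t) \<in> cyl x0 t0 k")
    case True
    then have x: "x \<in> ball x0 (rad k)" and t: "t \<in> I" by (auto simp: cyl_def I_def)
    \<comment> \<open>\<open>B\<close> has twice the radius of the base of the cylinder, as in
      \<open>local_quartic\<close>; passing to it only enlarges the integral.\<close>
    then have x2: "x \<in> B" using rad_pos[of k] by (auto simp: B_def)
    have slice: "continuous_on UNIV (\<Omega> t)"
      using continuous_on_compose2[OF cont, of UNIV "\<lambda>x. (x, t)"] t
      by (auto simp: I_def \<Omega>_def continuous_on_Pair)
    have "?L \<le> (\<Sum>m=0..k. ennreal (norm (shell_strain \<Gamma> \<phi> \<sigma> u k m t x))) *
        ennreal (cutoff \<eta> x0 t0 k x t * (norm (\<Omega> t x))\<^sup>2)"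
      using True stretching_le[OF \<eta>0] by (simp add: Let_def del: sum_ennreal)
    also have "\<dots> = (\<Sum>m=0..k. ennreal (norm (shell_strain \<Gamma> \<phi> \<sigma> u k m t x))) * (X (x, t) * N (x, t))"
      by (simp add: N[OF t] X_def ennreal_mult \<eta>0)
    also have "\<dots> \<le> (\<Sum>m=0..k. ennreal (c (k - m)) * ennreal_sqrt (E (k - m) t)) * (X (x, t) * N (x, t))"
    proof (intro mult_right_mono sum_mono)
      fix m assume "m \<in> {0..k}"
      then show "ennreal (norm (shell_strain \<Gamma> \<phi> \<sigma> u k m t x)) \<le> ennreal (c (k - m)) * ennreal_sqrt (E (k - m) t)"
        unfolding c_def E_def A_def N[OF t] \<Omega>_def
        using \<Gamma> x slice by (intro norm_shell_strain_le) (auto simp: \<Omega>_def)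
    qed simp
    also have "\<dots> = ?R"
      using x2 by (simp add: sum_distrib_right mult.assoc)
    finally show ?thesis .
  qed simp
  have tonelli: "(\<integral>\<^sup>+z. ennreal_sqrt (E j (snd z)) * (X z * N z * indicator (B) (fst z)) \<partial>lebesgue)
      = (\<integral>\<^sup>+t. ennreal_sqrt (E j t) * H t \<partial>lborel)" for j
  proof -
    have "(\<lambda>z. ennreal_sqrt (E j (snd z)) * (X z * N z * indicator (B) (fst z)))
        \<in> borel_measurable (borel \<Otimes>\<^sub>M borel)"
      by measurable
    then show ?thesis
      unfolding H_def borel_prod
      by (subst nn_integral_lebesgue_pair) (auto simp: nn_integral_cmult)
  qed
  \<comment> \<open>Monotonicity of the nonnegative integral asks for no measurability, so the
    stretching integrand is replaced at once by its Borel majorant.\<close>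
  have "mu_far_ann \<Gamma> \<eta> \<phi> \<sigma> x0 t0 u k \<le> ennreal (rad k) *
      (\<integral>\<^sup>+z. (\<Sum>m=0..k. ennreal (c (k - m)) * (ennreal_sqrt (E (k - m) (snd z)) *
         (X z * N z * indicator (B) (fst z)))) \<partial>lebesgue)"
    unfolding mu_far_ann_def \<Omega>_def[symmetric]
    using pointwise by (intro mult_left_mono nn_integral_mono) auto
  also have "\<dots> = ennreal (rad k) * (\<Sum>m=0..k. ennreal (c (k - m)) * (\<integral>\<^sup>+t. ennreal_sqrt (E (k - m) t) * H t \<partial>lborel))"
    unfolding nn_integral_completion tonelli[unfolded nn_integral_completion, symmetric]
    by (subst nn_integral_sum; (subst nn_integral_cmult)?) (simp_all flip: lborel_prod)
  also have "\<dots> \<le> ennreal (rad k) * (\<Sum>m=0..k. ennreal (c (k - m)) * (ennreal_sqrt (\<integral>\<^sup>+t. E (k - m) t \<partial>lborel) * Q))"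
    using nn_integral_Cauchy_Schwarz[of "\<lambda>t. ennreal_sqrt (E j t)" lborel H for j]
    by (intro mult_left_mono sum_mono) (simp_all add: Q_eq)
  also have "\<dots> = (\<Sum>m=0..k. ennreal (rad k * c (k - m)) * (ennreal_sqrt (\<integral>\<^sup>+t. E (k - m) t \<partial>lborel) * Q))"
    using rad_pos[of k] c by (simp add: sum_distrib_left ennreal_mult mult.assoc)
  \<comment> \<open>The sum is reversed by \<open>j = k - m\<close>, passing from shell numbers to
    reservoir indices.\<close>
  also have "\<dots> = (\<Sum>j=0..k. ennreal (rad k * c j) * (ennreal_sqrt (\<integral>\<^sup>+t. E j t \<partial>lborel) * Q))"
    by (subst (2) sum.atLeastAtMost_rev) simp
  also have "\<dots> = (\<Sum>j=0..k. ennreal (far_const \<Gamma>) * (ennreal ((1 / 2) ^ (k - j)) * reservoir_at \<Gamma> \<phi> \<sigma> x0 t0 u j k * Q))"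
  proof (intro sum.cong refl)
    fix j assume "j \<in> {0..k}"
    \<comment> \<open>Undoing the normalization \<open>1 / rad j\<close> under the root costs the
      factor \<open>sqrt (rad j)\<close> needed in \<open>shell_constant_eq\<close>.\<close>
    have "ennreal_sqrt (\<integral>\<^sup>+t. E j t \<partial>lborel) = ennreal (sqrt (rad j)) * reservoir_at \<Gamma> \<phi> \<sigma> x0 t0 u j k"
    proof -
      have "ennreal (rad j) * (ennreal (1 / rad j) * a) = a" for a
        using rad_pos[of j] by (simp flip: mult.assoc ennreal_mult)
      then show ?thesis
        using rad_pos[of j] unfolding R_eq
        by (simp add: less_imp_le flip: ennreal_sqrt_mult ennreal_sqrt_ennreal)
    qed
    then have "ennreal (rad k * c j) * (ennreal_sqrt (\<integral>\<^sup>+t. E j t \<partial>lborel) * Q) =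
        ennreal (rad k * c j * sqrt (rad j)) * (reservoir_at \<Gamma> \<phi> \<sigma> x0 t0 u j k * Q)"
      using rad_pos[of k] rad_pos[of j] c[of j] by (simp add: ennreal_mult mult.assoc)
    also have "rad k * c j * sqrt (rad j) = far_const \<Gamma> * (1 / 2) ^ (k - j)"
      unfolding c_def using \<Gamma> \<open>j \<in> {0..k}\<close> by (intro shell_constant_eq) auto
    finally show "ennreal (rad k * c j) * (ennreal_sqrt (\<integral>\<^sup>+t. E j t \<partial>lborel) * Q) =
        ennreal (far_const \<Gamma>) * (ennreal ((1 / 2) ^ (k - j)) * reservoir_at \<Gamma> \<phi> \<sigma> x0 t0 u j k * Q)"
      by (simp add: ennreal_mult'' mult.assoc)
  qed
  finally show ?thesis
    by (simp add: sum_distrib_left Q_def)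
qed

section \<open>Passage to the suprema and summation over scales\<close>

lemma reservoir_at_le_reservoir:
  "j \<le> k \<Longrightarrow> reservoir_at \<Gamma> \<phi> \<sigma> x0 t0 u j k \<le> reservoir \<Gamma> \<phi> \<sigma> x0 t0 u j"
  unfolding reservoir_def by (rule SUP_upper) simp

theorem proposition8p6:
  fixes \<Gamma> \<sigma> :: real
    and \<eta> :: "(real^3) \<times> real \<Rightarrow> real"
    and \<phi> :: "real^3 \<Rightarrow> real"
  assumes "0 < \<sigma>" and "\<sigma> < 1" and "1 < \<Gamma>"
    and "filter_profile \<phi>" and "cutoff_profile \<eta>"
  shows "\<exists>C0::real. 0 \<le> C0 \<and>
    (\<forall>(x0::real^3) (t0::real) (a::real) (b::real) (u :: real \<Rightarrow> real^3 \<Rightarrow> real^3).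
       a \<le> t0 - 1 \<and> t0 \<le> b \<and> leray_hopf a b u \<longrightarrow>
       (\<forall>k::nat.
          mu_far_ann \<Gamma> \<eta> \<phi> \<sigma> x0 t0 u k
            \<le> ennreal C0 * (\<Sum>j=0..k. ennreal ((1 / 2) ^ (k - j)) *
                 reservoir_at \<Gamma> \<phi> \<sigma> x0 t0 u j k * local_quartic \<eta> \<phi> \<sigma> x0 t0 u k) \<and>
          ennreal C0 * (\<Sum>j=0..k. ennreal ((1 / 2) ^ (k - j)) *
                 reservoir_at \<Gamma> \<phi> \<sigma> x0 t0 u j k * local_quartic \<eta> \<phi> \<sigma> x0 t0 u k)
            \<le> ennreal C0 * (\<Sum>j=0..k. ennreal ((1 / 2) ^ (k - j)) *
                 reservoir \<Gamma> \<phi> \<sigma> x0 t0 u j * local_quartic \<eta> \<phi> \<sigma> x0 t0 u k)) \<and>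
       (\<forall>N::nat.
          (\<Sum>k=0..N. mu_far_ann \<Gamma> \<eta> \<phi> \<sigma> x0 t0 u k)
            \<le> ennreal C0 * (\<Sum>j=0..N. reservoir \<Gamma> \<phi> \<sigma> x0 t0 u j *
                 (\<Sum>m=0..N - j. ennreal ((1 / 2) ^ m) * local_quartic \<eta> \<phi> \<sigma> x0 t0 u (j + m)))))"
proof (intro exI[of _ "far_const \<Gamma>"] conjI allI impI)
  show "0 \<le> far_const \<Gamma>" using assms(3) by (simp add: far_const_def)
  fix x0 :: "real^3" and t0 a b :: real and u :: "real \<Rightarrow> real^3 \<Rightarrow> real^3"
  assume lh: "a \<le> t0 - 1 \<and> t0 \<le> b \<and> leray_hopf a b u"
  let ?R = "reservoir \<Gamma> \<phi> \<sigma> x0 t0 u" and ?Q = "local_quartic \<eta> \<phi> \<sigma> x0 t0 u"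
  \<comment> \<open>Every \<open>rad k\<close> is at most 1, so the assumption that \<open>a\<close>
    is at most \<open>t0 - 1\<close> places all the time intervals where the solution lives.\<close>
  have "time_int t0 k \<subseteq> {a..<b}" for k
  proof -
    have "(rad k)\<^sup>2 \<le> 1" by (simp add: rad_def power_le_one)
    then show ?thesis using lh by (auto simp: time_int_def)
  qed
  then have cont: "continuous_on (UNIV \<times> time_int t0 k) (\<lambda>(x, t). filtered_vorticity \<phi> \<sigma> u k t x)" for k
    using filtered_vorticity_continuous[OF _ assms(4,1)] lh
    by (meson Sigma_mono continuous_on_subset order_refl)
  show first: "mu_far_ann \<Gamma> \<eta> \<phi> \<sigma> x0 t0 u k
            \<le> ennreal (far_const \<Gamma>) * (\<Sum>j=0..k. ennreal ((1 / 2) ^ (k - j)) *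
                 reservoir_at \<Gamma> \<phi> \<sigma> x0 t0 u j k * ?Q k)" for k
    by (rule mu_far_ann_le[OF assms(3,5) cont])
  show second: "ennreal (far_const \<Gamma>) * (\<Sum>j=0..k. ennreal ((1 / 2) ^ (k - j)) *
                 reservoir_at \<Gamma> \<phi> \<sigma> x0 t0 u j k * ?Q k)
            \<le> ennreal (far_const \<Gamma>) * (\<Sum>j=0..k. ennreal ((1 / 2) ^ (k - j)) * ?R j * ?Q k)" for k
    by (intro mult_left_mono mult_right_mono sum_mono reservoir_at_le_reservoir) auto
  fix N :: nat
  have "(\<Sum>k=0..N. mu_far_ann \<Gamma> \<eta> \<phi> \<sigma> x0 t0 u k)
      \<le> (\<Sum>k=0..N. ennreal (far_const \<Gamma>) * (\<Sum>j=0..k. ennreal ((1 / 2) ^ (k - j)) * ?R j * ?Q k))"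
    by (intro sum_mono order_trans[OF first second])
  \<comment> \<open>After the exchange the scale is \<open>k = j + m\<close>, so the decay exponent
    \<open>k - j\<close> becomes \<open>m\<close>.\<close>
  also have "\<dots> = ennreal (far_const \<Gamma>) *
      (\<Sum>j=0..N. \<Sum>m=0..N - j. ennreal ((1 / 2) ^ (j + m - j)) * ?R j * ?Q (j + m))"
    using sum_triangle_diagonals[of "\<lambda>j k. ennreal ((1 / 2) ^ (k - j)) * ?R j * ?Q k" N]
    by (simp flip: sum_distrib_left)
  also have "\<dots> = ennreal (far_const \<Gamma>) * (\<Sum>j=0..N. ?R j * (\<Sum>m=0..N - j. ennreal ((1 / 2) ^ m) * ?Q (j + m)))"
    by (simp add: sum_distrib_left ac_simps)
  finally show "(\<Sum>k=0..N. mu_far_ann \<Gamma> \<eta> \<phi> \<sigma> x0 t0 u k)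
            \<le> ennreal (far_const \<Gamma>) * (\<Sum>j=0..N. ?R j * (\<Sum>m=0..N - j. ennreal ((1 / 2) ^ m) * ?Q (j + m)))" .
qed

end
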